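(* Let $A\in\mathbb{R}^{m\times n}$, $b\in\mathbb{R}^m$, $\lambda>0$, let $M\in\mathbb{R}^{n\times n}$ be symmetric positive definite, and let $U=(u_1,\dots,u_m)$, $V=(v_1,\dots,v_n)$, $\sigma_1\geq\dots\geq\sigma_r>0$ be a weighted SVD of $A$ with weight matrix $M$. Then the solution to the Tikhonov regularization problem $$\min_{x\in\mathbb{R}^n}\|Ax-b\|_2^2+\lambda\|x\|_M^2$$ can be written as $$x_\lambda=\sum_{i=1}^{r}\frac{\sigma_i^2}{\sigma_i^2+\lambda}\,\frac{u_i^{\top}b}{\sigma_i}\,v_i.$$
   Context: For $x\in\mathbb{R}^n$, $\|x\|_M:=(x^{\top}Mx)^{1/2}$. Weighted SVD (WSVD) of $A$ with weight matrix $M$: a factorization $U^{\top}AV=\begin{pmatrix}\Sigma_r&\mathbf{0}\\ \mathbf{0}&\mathbf{0}\end{pmatrix}\in\mathbb{R}^{m\times n}$, where $U=(u_1,\dots,u_m)\in\mathbb{R}^{m\times m}$ satisfies $U^{\top}U=I_m$, $V=(v_1,\dots,v_n)\in\mathbb{R}^{n\times n}$ satisfies $V^{\top}MV=I_n$, and $\Sigma_r=\mathrm{diag}(\sigma_1,\dots,\sigma_r)$ with $\sigma_1\geq\dots\geq\sigma_r>0$, $r=\mathrm{rank}(A)$. *)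

theory Defs
  imports Complex_Main "Jordan_Normal_Form.DL_Rank"
begin

definition spd_mat :: "nat \<Rightarrow> real mat \<Rightarrow> bool" where
  "spd_mat n M \<longleftrightarrow> M \<in> carrier_mat n n \<and> transpose_mat M = M \<and>
     (\<forall>x \<in> carrier_vec n. x \<noteq> 0\<^sub>v n \<longrightarrow> x \<bullet> (M *\<^sub>v x) > 0)"

definition norm2_vec :: "real vec \<Rightarrow> real" where
  "norm2_vec x = sqrt (x \<bullet> x)"

definition wnorm_vec :: "real mat \<Rightarrow> real vec \<Rightarrow> real" where
  "wnorm_vec M x = sqrt (x \<bullet> (M *\<^sub>v x))"

(* Indices start at 0: u_i is col U (i - 1), v_i is col V (i - 1), and sigma_i is \<sigma> (i - 1).
   Only the values of \<sigma> below r matter. *)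
definition is_WSVD ::
  "nat \<Rightarrow> nat \<Rightarrow> real mat \<Rightarrow> real mat \<Rightarrow> nat \<Rightarrow> real mat \<Rightarrow> (nat \<Rightarrow> real) \<Rightarrow> real mat \<Rightarrow> bool" where
  "is_WSVD m n A M r U \<sigma> V \<longleftrightarrow>
     U \<in> carrier_mat m m \<and> V \<in> carrier_mat n n \<and>
     transpose_mat U * U = 1\<^sub>m m \<and>
     transpose_mat V * M * V = 1\<^sub>m n \<and>
     r = vec_space.rank m A \<and>
     (\<forall>i<r. \<sigma> i > 0) \<and> (\<forall>i j. i \<le> j \<longrightarrow> j < r \<longrightarrow> \<sigma> j \<le> \<sigma> i) \<and>
     transpose_mat U * A * V =
       four_block_mat (mat_diag r \<sigma>) (0\<^sub>m r (n - r)) (0\<^sub>m (m - r) r) (0\<^sub>m (m - r) (n - r))"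

definition tikhonov_objective :: "real mat \<Rightarrow> real vec \<Rightarrow> real \<Rightarrow> real mat \<Rightarrow> real vec \<Rightarrow> real" where
  "tikhonov_objective A b reg M x = (norm2_vec (A *\<^sub>v x - b))\<^sup>2 + reg * (wnorm_vec M x)\<^sup>2"

end

theory Submission
  imports Defs
begin

text \<open>
  Writing x = V y and c = U^T b, the weighted SVD decouples the objective into
  scalar quadratics in the coordinates of y. Completing the square in each coordinate gives
  the unique minimiser: y_i = \<sigma>_i c_i / (\<sigma>_i^2 + \<lambda>) for i < r and y_i = 0 otherwise.
\<close>

lemma norm2_vec_square: "(norm2_vec x)\<^sup>2 = (x \<bullet> x)"
  by (simp add: norm2_vec_def scalar_prod_def sum_nonneg)

text \<open>Moves \<open>P\<close> across the scalar product as its adjoint. With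
  \<open>P = Q = transpose_mat U\<close> it yields the isometry of U^T; with \<open>P = V\<close>
  and \<open>Q = M * V\<close> it yields the weighted norm in coordinates.\<close>

lemma scalar_prod_transpose_mult:
  fixes P Q :: "real mat"
  assumes "P \<in> carrier_mat k n" "Q \<in> carrier_mat k l" "x \<in> carrier_vec n" "y \<in> carrier_vec l"
  shows "(P *\<^sub>v x) \<bullet> (Q *\<^sub>v y) = x \<bullet> ((transpose_mat P * Q) *\<^sub>v y)"
proof -
  have "(P *\<^sub>v x) \<bullet> (Q *\<^sub>v y) = x \<bullet> (transpose_mat P *\<^sub>v (Q *\<^sub>v y))"
    using transpose_vec_mult_scalar[of "transpose_mat P" n k "Q *\<^sub>v y" x] assms
    by simp
  then show ?thesis
    using assms by (simp add: assoc_mult_mat_vec[of _ n k _ l])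
qed

text \<open>Subtraction on naturals truncates, so the block matrix has max r m rows and max r n
  columns. Being equal to an m by n product forces both bounds.\<close>

lemma is_WSVD_rank_le:
  assumes "is_WSVD m n A M r U \<sigma> V"
  shows "r \<le> m" "r \<le> n"
proof -
  let ?D = "four_block_mat (mat_diag r \<sigma>) (0\<^sub>m r (n - r)) (0\<^sub>m (m - r) r) (0\<^sub>m (m - r) (n - r))"
  have U: "U \<in> carrier_mat m m" and V: "V \<in> carrier_mat n n" and D: "transpose_mat U * A * V = ?D"
    using assms unfolding is_WSVD_def by auto
  have "dim_row ?D = m" "dim_col ?D = n"
    unfolding D[symmetric] using U V by simp_all
  then show "r \<le> m" "r \<le> n"
    by (simp_all add: mat_diag_def)
qed

lemma mult_rectangular_diag_vec:
  fixes y :: "real vec"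
  assumes "r \<le> m" "r \<le> n" "y \<in> carrier_vec n"
  shows "four_block_mat (mat_diag r \<sigma>) (0\<^sub>m r (n - r)) (0\<^sub>m (m - r) r) (0\<^sub>m (m - r) (n - r)) *\<^sub>v y
    = vec m (\<lambda>i. if i < r then \<sigma> i * y $ i else 0)" (is "?D *\<^sub>v y = _")
proof (rule eq_vecI)
  show "dim_vec (?D *\<^sub>v y) = dim_vec (vec m (\<lambda>i. if i < r then \<sigma> i * y $ i else 0))"
    using assms by (simp add: mat_diag_def)
next
  fix i assume "i < dim_vec (vec m (\<lambda>i. if i < r then \<sigma> i * y $ i else 0))"
  then have i: "i < m" by simp
  \<comment> \<open>One formula for all four blocks lets the row sum collapse to a single term. Rows
    with i \<ge> r vanish, which includes any row i \<ge> n that has no diagonal entry.\<close>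
  have entry: "?D $$ (i, j) = (if j = i then (if i < r then \<sigma> i else 0) else 0)"
    if "j < n" for j
    using that i assms by (auto simp: mat_diag_def)
  have "(?D *\<^sub>v y) $ i = (\<Sum>j\<in>{0..<n}. ?D $$ (i, j) * y $ j)"
    using i assms by (simp add: mat_diag_def scalar_prod_def)
  also have "\<dots> = (\<Sum>j\<in>{0..<n}. if j = i then (if i < r then \<sigma> i * y $ i else 0) else 0)"
    by (rule sum.cong) (auto simp: entry)
  also have "\<dots> = (if i < r then \<sigma> i * y $ i else 0)"
    using assms by simp
  finally show "(?D *\<^sub>v y) $ i = vec m (\<lambda>i. if i < r then \<sigma> i * y $ i else 0) $ i"
    using i by simp
qed

text \<open>U^T preserves the Euclidean norm, so the residual may be measured in the basis of the
  columns of \<open>U\<close>, where \<open>A * V\<close> becomes diagonal. The relation V^T M V = I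
  turns the \<open>M\<close>-norm of V y into the Euclidean norm of y.\<close>

lemma tikhonov_objective_WSVD_coordinates:
  assumes A: "A \<in> carrier_mat m n" and b: "b \<in> carrier_vec m" and M: "M \<in> carrier_mat n n"
    and W: "is_WSVD m n A M r U \<sigma> V" and y: "y \<in> carrier_vec n"
  shows "tikhonov_objective A b reg M (V *\<^sub>v y) =
    (\<Sum>i<m. ((if i < r then \<sigma> i * y $ i else 0) - col U i \<bullet> b)\<^sup>2) + reg * (\<Sum>i<n. (y $ i)\<^sup>2)"
proof -
  let ?D = "four_block_mat (mat_diag r \<sigma>) (0\<^sub>m r (n - r)) (0\<^sub>m (m - r) r) (0\<^sub>m (m - r) (n - r))"
  have U: "U \<in> carrier_mat m m" and V: "V \<in> carrier_mat n n"
    and UU: "transpose_mat U * U = 1\<^sub>m m" and VMV: "transpose_mat V * M * V = 1\<^sub>m n"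
    and D: "transpose_mat U * A * V = ?D"
    using W unfolding is_WSVD_def by auto
  \<comment> \<open>The isometry of U^T, rather than of \<open>U\<close>, requires the product in
    this order; it follows because \<open>U\<close> is square.\<close>
  have UU': "U * transpose_mat U = 1\<^sub>m m"
    using mat_mult_left_right_inverse[OF _ U UU] U by simp
  let ?w = "A *\<^sub>v (V *\<^sub>v y) - b"
  have w: "?w \<in> carrier_vec m"
    using A V y b by auto
  have Ut: "transpose_mat U \<in> carrier_mat m m" using U by simp
  have "transpose_mat U *\<^sub>v ?w = transpose_mat U *\<^sub>v (A *\<^sub>v (V *\<^sub>v y)) - transpose_mat U *\<^sub>v b"
    using A V y b Ut by (intro mult_minus_distrib_mat_vec) auto
  also have "transpose_mat U *\<^sub>v (A *\<^sub>v (V *\<^sub>v y)) = ?D *\<^sub>v y"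
    using A V y Ut unfolding D[symmetric]
    by (simp add: assoc_mult_mat_vec[of _ m n _ n] assoc_mult_mat_vec[of _ m m _ n])
  finally have Uw: "transpose_mat U *\<^sub>v ?w =
      vec m (\<lambda>i. (if i < r then \<sigma> i * y $ i else 0) - col U i \<bullet> b)"
    using mult_rectangular_diag_vec[OF is_WSVD_rank_le[OF W] y] U
    by (intro eq_vecI) auto
  have "?w \<bullet> ?w = (transpose_mat U *\<^sub>v ?w) \<bullet> (transpose_mat U *\<^sub>v ?w)"
    using scalar_prod_transpose_mult[OF Ut Ut w w] UU' w by simp
  then have res: "(norm2_vec ?w)\<^sup>2 = (\<Sum>i<m. ((if i < r then \<sigma> i * y $ i else 0) - col U i \<bullet> b)\<^sup>2)"
    unfolding norm2_vec_square Uw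
    by (simp add: scalar_prod_def power2_eq_square atLeast0LessThan)
  have "(V *\<^sub>v y) \<bullet> (M *\<^sub>v (V *\<^sub>v y)) = (V *\<^sub>v y) \<bullet> ((M * V) *\<^sub>v y)"
    using M V y by (simp add: assoc_mult_mat_vec[of _ n n _ n])
  also have "\<dots> = y \<bullet> ((transpose_mat V * (M * V)) *\<^sub>v y)"
    using M V y by (intro scalar_prod_transpose_mult) auto
  also have "transpose_mat V * (M * V) = 1\<^sub>m n"
    using assoc_mult_mat[of "transpose_mat V" n n M n V n] M V VMV by simp
  finally have "(V *\<^sub>v y) \<bullet> (M *\<^sub>v (V *\<^sub>v y)) = (\<Sum>i<n. (y $ i)\<^sup>2)"
    using y by (simp add: scalar_prod_def power2_eq_square atLeast0LessThan)
  \<comment> \<open>The quadratic form is now a sum of squares, hence nonnegative, so squaring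
    undoes the \<open>sqrt\<close>.\<close>
  then have "(wnorm_vec M (V *\<^sub>v y))\<^sup>2 = (\<Sum>i<n. (y $ i)\<^sup>2)"
    by (simp add: wnorm_vec_def sum_nonneg)
  with res show ?thesis
    by (simp add: tikhonov_objective_def)
qed

text \<open>\<open>t0\<close> solves the scalar normal equation (s^2 + reg) t = s c. The excess over
  the minimum is given exactly, so that minimality and uniqueness can both be read off.\<close>

lemma tikhonov_complete_square:
  fixes s c t reg :: real
  assumes "reg > 0"
  defines "t0 \<equiv> s * c / (s\<^sup>2 + reg)"
  shows "(s * t - c)\<^sup>2 + reg * t\<^sup>2 = (s * t0 - c)\<^sup>2 + reg * t0\<^sup>2 + (s\<^sup>2 + reg) * (t - t0)\<^sup>2"
proof -
  have "s\<^sup>2 + reg \<noteq> 0"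
    using assms(1) by (smt (verit) zero_le_power2)
  then have normal_eq: "s * c = (s\<^sup>2 + reg) * t0"
    by (simp add: t0_def)
  have "(s * u - c)\<^sup>2 + reg * u\<^sup>2 = (s\<^sup>2 + reg) * u\<^sup>2 - 2 * (s * c) * u + c\<^sup>2" for u
    by (simp add: power2_eq_square algebra_simps)
  \<comment> \<open>Eliminating s c in favour of \<open>t0\<close> removes the division; a
    polynomial identity remains.\<close>
  then have expand: "(s * u - c)\<^sup>2 + reg * u\<^sup>2 =
      (s\<^sup>2 + reg) * u\<^sup>2 - 2 * ((s\<^sup>2 + reg) * t0) * u + c\<^sup>2" for u
    by (simp only: normal_eq)
  show ?thesis
    unfolding expand by (simp add: power2_eq_square algebra_simps)
qed

text \<open>A matrix-vector product combines the columns, and the zero coordinates discard those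
  from index r on. This gives the minimiser the shape of the claimed sum.\<close>

lemma mult_mat_vec_eq_finsum_cols:
  fixes V :: "real mat"
  assumes V: "V \<in> carrier_mat n n" and "r \<le> n"
  shows "V *\<^sub>v vec n (\<lambda>i. if i < r then a i else 0) =
    finsum_vec TYPE(real) n (\<lambda>i. a i \<cdot>\<^sub>v col V i) {..<r}"
proof (rule eq_vecI)
  have c: "(\<lambda>i. a i \<cdot>\<^sub>v col V i) \<in> {..<r} \<rightarrow> carrier_vec n"
    using V by auto
  have "finsum_vec TYPE(real) n (\<lambda>i. a i \<cdot>\<^sub>v col V i) {..<r} \<in> carrier_vec n"
    using c by (rule finsum_vec_closed)
  then have dim: "dim_vec (finsum_vec TYPE(real) n (\<lambda>i. a i \<cdot>\<^sub>v col V i) {..<r}) = n"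
    by simp
  then show "dim_vec (V *\<^sub>v vec n (\<lambda>i. if i < r then a i else 0)) =
      dim_vec (finsum_vec TYPE(real) n (\<lambda>i. a i \<cdot>\<^sub>v col V i) {..<r})"
    using V by simp
  fix k assume "k < dim_vec (finsum_vec TYPE(real) n (\<lambda>i. a i \<cdot>\<^sub>v col V i) {..<r})"
  with dim have k: "k < n" by simp
  have "(V *\<^sub>v vec n (\<lambda>i. if i < r then a i else 0)) $ k =
      (\<Sum>i\<in>{0..<n}. if i < r then a i * V $$ (k, i) else 0)"
    using V k by (auto simp: scalar_prod_def intro!: sum.cong)
  also have "\<dots> = (\<Sum>i<r. a i * V $$ (k, i))"
    using \<open>r \<le> n\<close> by (intro sum.mono_neutral_cong_right) auto
  also have "\<dots> = (\<Sum>i<r. (a i \<cdot>\<^sub>v col V i) $ k)"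
    using V k \<open>r \<le> n\<close> by (intro sum.cong) auto
  also have "\<dots> = finsum_vec TYPE(real) n (\<lambda>i. a i \<cdot>\<^sub>v col V i) {..<r} $ k"
    using index_finsum_vec[OF _ k c] by simp
  finally show "(V *\<^sub>v vec n (\<lambda>i. if i < r then a i else 0)) $ k =
      finsum_vec TYPE(real) n (\<lambda>i. a i \<cdot>\<^sub>v col V i) {..<r} $ k" .
qed

theorem theorem5p1:
  fixes m n r :: nat and A M U V :: "real mat" and b :: "real vec"
    and reg :: real and \<sigma> :: "nat \<Rightarrow> real"
  assumes "A \<in> carrier_mat m n"
    and "b \<in> carrier_vec m"
    and "reg > 0"
    and "spd_mat n M"
    and "is_WSVD m n A M r U \<sigma> V"
  shows "{x. is_arg_min (tikhonov_objective A b reg M) (\<lambda>x. x \<in> carrier_vec n) x} =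
    {finsum_vec TYPE(real) n
       (\<lambda>i. ((\<sigma> i)\<^sup>2 / ((\<sigma> i)\<^sup>2 + reg) * ((col U i \<bullet> b) / \<sigma> i)) \<cdot>\<^sub>v col V i) {..<r}}"
proof -
  let ?f = "tikhonov_objective A b reg M"
  let ?c = "\<lambda>i. col U i \<bullet> b"
  have M: "M \<in> carrier_mat n n"
    using assms(4) by (simp add: spd_mat_def)
  have V: "V \<in> carrier_mat n n" and VMV: "transpose_mat V * M * V = 1\<^sub>m n"
    and pos: "\<And>i. i < r \<Longrightarrow> \<sigma> i > 0"
    using assms(5) unfolding is_WSVD_def by auto
  have rm: "r \<le> m" and rn: "r \<le> n"
    using is_WSVD_rank_le[OF assms(5)] .
  have VtM: "transpose_mat V * M \<in> carrier_mat n n"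
    using V M by simp
  \<comment> \<open>V^T M is a left inverse of the square matrix \<open>V\<close>, hence also a
    right inverse. Thus every x has coordinates y = V^T M x, and minimising over y misses no
    x.\<close>
  have inv: "V * (transpose_mat V * M) = 1\<^sub>m n"
    using mat_mult_left_right_inverse[OF VtM V VMV] .
  have surj: "\<exists>y \<in> carrier_vec n. x = V *\<^sub>v y" if "x \<in> carrier_vec n" for x
  proof
    show "x = V *\<^sub>v ((transpose_mat V * M) *\<^sub>v x)"
      using assoc_mult_mat_vec[OF V VtM that] inv that by simp
    show "(transpose_mat V * M) *\<^sub>v x \<in> carrier_vec n"
      using VtM that by (rule mult_mat_vec_carrier)
  qed
  \<comment> \<open>The coefficients keep the form with filter factors from the claim; cancelling
    one \<sigma> i > 0 in \<open>y0_lt\<close> gives the \<open>t0\<close> of the completed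
    square.\<close>
  define y0 where "y0 = vec n (\<lambda>i. if i < r then (\<sigma> i)\<^sup>2 / ((\<sigma> i)\<^sup>2 + reg) * (?c i / \<sigma> i) else 0)"
  have y0: "y0 \<in> carrier_vec n" by (simp add: y0_def)
  have y0_lt: "y0 $ i = \<sigma> i * ?c i / ((\<sigma> i)\<^sup>2 + reg)" if "i < r" for i
    using that rn pos[OF that] by (simp add: y0_def power2_eq_square)
  have y0_ge: "y0 $ i = 0" if "i < n" "\<not> i < r" for i
    using that by (simp add: y0_def)
  \<comment> \<open>The objective without the residual components along u_i for i \<ge> r, which are
    the same for every y.\<close>
  define g where "g y = (\<Sum>i<r. (\<sigma> i * y $ i - ?c i)\<^sup>2 + reg * (y $ i)\<^sup>2)
    + reg * (\<Sum>i\<in>{r..<n}. (y $ i)\<^sup>2)" for y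
  have f: "?f (V *\<^sub>v y) = g y + (\<Sum>i\<in>{r..<m}. (?c i)\<^sup>2)" if y: "y \<in> carrier_vec n" for y
  proof -
    have m: "{..<m} = {..<r} \<union> {r..<m}" and n: "{..<n} = {..<r} \<union> {r..<n}"
      using rm rn by auto
    show ?thesis
      unfolding tikhonov_objective_WSVD_coordinates[OF assms(1,2) M assms(5) y] g_def m n
      by (simp add: sum.union_disjoint ivl_disj_int sum.distrib sum_distrib_left distrib_left)
  qed
  \<comment> \<open>The square is completed for each i < r. From r on \<open>y0\<close> is zero, so
    there the penalty itself is the excess.\<close>
  have gap: "g y = g y0 + (\<Sum>i<r. ((\<sigma> i)\<^sup>2 + reg) * (y $ i - y0 $ i)\<^sup>2)
      + reg * (\<Sum>i\<in>{r..<n}. (y $ i)\<^sup>2)" for y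
  proof -
    have "(\<Sum>i<r. (\<sigma> i * y $ i - ?c i)\<^sup>2 + reg * (y $ i)\<^sup>2) =
      (\<Sum>i<r. ((\<sigma> i * y0 $ i - ?c i)\<^sup>2 + reg * (y0 $ i)\<^sup>2) + ((\<sigma> i)\<^sup>2 + reg) * (y $ i - y0 $ i)\<^sup>2)"
    proof (intro sum.cong refl)
      fix i assume "i \<in> {..<r}"
      then show "(\<sigma> i * y $ i - ?c i)\<^sup>2 + reg * (y $ i)\<^sup>2 =
          ((\<sigma> i * y0 $ i - ?c i)\<^sup>2 + reg * (y0 $ i)\<^sup>2) + ((\<sigma> i)\<^sup>2 + reg) * (y $ i - y0 $ i)\<^sup>2"
        using tikhonov_complete_square[OF assms(3), of "\<sigma> i" "y $ i" "?c i"] y0_lt[of i] by simp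
    qed
    moreover have "(\<Sum>i\<in>{r..<n}. (y0 $ i)\<^sup>2) = 0"
      by (simp add: y0_ge)
    ultimately show ?thesis
      by (simp add: g_def sum.distrib)
  qed
  have nonneg: "0 \<le> (\<Sum>i<r. ((\<sigma> i)\<^sup>2 + reg) * (y $ i - y0 $ i)\<^sup>2)"
      "0 \<le> reg * (\<Sum>i\<in>{r..<n}. (y $ i)\<^sup>2)" for y
    using assms(3) by (auto intro!: sum_nonneg mult_nonneg_nonneg)
  have le: "g y0 \<le> g y" for y
    using gap[of y] nonneg[of y] by linarith
  \<comment> \<open>Both excess terms are nonnegative, so they vanish; as \<open>reg > 0\<close>,
    all their weights are positive and every coordinate is determined.\<close>
  have uniq: "y = y0" if y: "y \<in> carrier_vec n" and "g y \<le> g y0" for y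
  proof (rule eq_vecI)
    have "(\<Sum>i<r. ((\<sigma> i)\<^sup>2 + reg) * (y $ i - y0 $ i)\<^sup>2) = 0"
      and "reg * (\<Sum>i\<in>{r..<n}. (y $ i)\<^sup>2) = 0"
      using gap[of y] nonneg[of y] that(2) by linarith+
    then have "\<forall>i<r. ((\<sigma> i)\<^sup>2 + reg) * (y $ i - y0 $ i)\<^sup>2 = 0" and "\<forall>i\<in>{r..<n}. y $ i = 0"
      using assms(3) by (auto simp: sum_nonneg_eq_0_iff)
    moreover have "(\<sigma> i)\<^sup>2 + reg \<noteq> 0" for i
      using assms(3) by (smt (verit) zero_le_power2)
    ultimately show "y $ i = y0 $ i" if "i < dim_vec y0" for i
      using that y0 y0_ge by (cases "i < r") auto
    show "dim_vec y = dim_vec y0" using y y0 by simp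
  qed
  have "is_arg_min ?f (\<lambda>x. x \<in> carrier_vec n) x \<longleftrightarrow> x = V *\<^sub>v y0" for x
  proof
    assume *: "is_arg_min ?f (\<lambda>x. x \<in> carrier_vec n) x"
    then obtain y where y: "y \<in> carrier_vec n" and x: "x = V *\<^sub>v y"
      using surj unfolding is_arg_min_def by blast
    \<comment> \<open>Comparison with this one feasible point suffices: the constant cancels and
      \<open>uniq\<close> applies.\<close>
    have "V *\<^sub>v y0 \<in> carrier_vec n"
      using V y0 by (rule mult_mat_vec_carrier)
    with * have "?f x \<le> ?f (V *\<^sub>v y0)"
      unfolding is_arg_min_linorder by blast
    then show "x = V *\<^sub>v y0"
      using uniq[OF y] by (simp add: x f[OF y] f[OF y0])
  next
    assume x: "x = V *\<^sub>v y0"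
    have "?f x \<le> ?f z" if z: "z \<in> carrier_vec n" for z
    proof -
      obtain y where "y \<in> carrier_vec n" "z = V *\<^sub>v y"
        using surj[OF z] by blast
      then show ?thesis
        using le[of y] by (simp add: x f y0)
    qed
    then show "is_arg_min ?f (\<lambda>x. x \<in> carrier_vec n) x"
      using V y0 unfolding is_arg_min_linorder x by (auto intro: mult_mat_vec_carrier)
  qed
  then show ?thesis
    unfolding y0_def mult_mat_vec_eq_finsum_cols[OF V rn] by blast
qed

end
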